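(* Let $n,k,m$ be positive integers with $k\le m\le n-2$, and let $G$ be a graph of order $n$ with minimum degree $\delta(G)\ge k$ and maximum degree $\Delta(G)\le m$. Then $$ R'(G)\ \ge\ \begin{cases} \dfrac n2-\dfrac12\left(\dfrac1k-\dfrac1m\right)k(n-k) & \text{if } k\le \dfrac n2 \text{ and } n-k\le m\le n-2,\\[2ex] \dfrac n2-\dfrac12\left(\dfrac1k-\dfrac1m\right)\dfrac{n^2}{4} & \text{if } \dfrac n2\le k\le m\le n-2. \end{cases} $$ Moreover: (i) For $k\le\frac n2$ (the first bound), equality holds if $k$ is even, or if $k$ and $n-m$ are odd, and this value is attained by graphs for which $n_k=n-k$, $n_m=k$, $x_{k,m}=(n-k)k$, $x_{m,m}=\frac{k(k+m-n)}{2}$, and all other $x_{i,j}$, $x_{i,i}$ and $n_i$ are equal to zero. (ii) For $k\ge\frac n2$ (the second bound), equality holds if $n\equiv 0\pmod 4$, or if $n\equiv 2\pmod 4$ and $k$ and $m$ are odd, and this value is attained by graphs $G\in\mathcal G_{n,n/2,k,m}$ for which $n_k=n_m=\frac n2$, $x_{k,k}=\frac{n(2k-n)}{8}$, $x_{k,m}=\frac{n^2}{4}$, $x_{m,m}=\frac{n(2m-n)}{8}$, and all other $x_{i,j}$, $x_{i,i}$ and $n_i$ are equal to zero.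
   Context: Graphs are finite and simple. For a graph $G$, $d(u)$ denotes the degree of the vertex $u$, $E(G)$ the edge set, $\delta(G)$ the minimum degree and $\Delta(G)$ the maximum degree. The variation of the Randić index is $$R'(G)=\sum_{uv\in E(G)}\frac{1}{\max\{d(u),d(v)\}}.$$ For a graph $G$, $n_i$ denotes the number of vertices of degree $i$, and $x_{i,j}$ (with $i\le j$) denotes the number of edges joining a vertex of degree $i$ to a vertex of degree $j$. $\mathcal G_{n,p,k,m}$ denotes the family of complements of the $n$-vertex graphs consisting of an $(n-k-1)$-regular graph on $p$ vertices together with a (disjoint) $(n-m-1)$-regular graph on the other $n-p$ vertices.
   Formalization: For k=m the listed values of n_k, n_m and x_{k,k}, x_{k,m}, x_{m,m} contradict each other (e.g. n=4, k=m=2); in that case they are read as contributions to be added up: n_k=n, and x_{k,k} is the sum of the listed edge counts. For k<m the list is as stated. *)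

theory Defs
  imports Complex_Main
begin

definition simple_graph :: "'a set \<Rightarrow> 'a set set \<Rightarrow> bool" where
  "simple_graph V E \<longleftrightarrow> finite V \<and> (\<forall>e\<in>E. e \<subseteq> V \<and> card e = 2)"

definition degree :: "'a set set \<Rightarrow> 'a \<Rightarrow> nat" where
  "degree E v = card {e \<in> E. v \<in> e}"

definition min_degree :: "'a set \<Rightarrow> 'a set set \<Rightarrow> nat" where
  "min_degree V E = Min (degree E ` V)"

definition max_degree :: "'a set \<Rightarrow> 'a set set \<Rightarrow> nat" where
  "max_degree V E = Max (degree E ` V)"

text \<open>For an edge \<open>e = {u, v}\<close>, the image \<open>degree E ` e\<close> is \<open>{d(u), d(v)}\<close>.\<close>

definition randic_var :: "'a set set \<Rightarrow> real" where
  "randic_var E = (\<Sum>e\<in>E. 1 / real (Max (degree E ` e)))"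

definition num_vertices :: "'a set \<Rightarrow> 'a set set \<Rightarrow> nat \<Rightarrow> nat" where
  "num_vertices V E i = card {v \<in> V. degree E v = i}"

definition num_edges :: "'a set set \<Rightarrow> nat \<Rightarrow> nat \<Rightarrow> nat" where
  "num_edges E i j = card {e \<in> E. \<exists>u v. e = {u, v} \<and> degree E u = i \<and> degree E v = j}"

definition bounded_degree_graph ::
    "nat \<Rightarrow> nat \<Rightarrow> nat \<Rightarrow> 'a set \<Rightarrow> 'a set set \<Rightarrow> bool" where
  "bounded_degree_graph n k m V E \<longleftrightarrow>
     simple_graph V E \<and> card V = n \<and> k \<le> min_degree V E \<and> max_degree V E \<le> m"

text \<open>
  The graph has \<open>a\<close> vertices of degree \<open>k\<close> and \<open>b\<close> of degree \<open>m\<close>, with \<open>xkk\<close>, \<open>xkm\<close> and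
  \<open>xmm\<close> edges between the respective degree classes, and no other vertices or edges.
  For \<open>k < m\<close> at most one summand on each right-hand side is nonzero, so this says
  \<open>n\<^sub>k = a\<close>, \<open>n\<^sub>m = b\<close>, \<open>x\<^sub>k\<^sub>,\<^sub>k = xkk\<close>, and so on.
  For \<open>k = m\<close> the two degree classes coincide and their contributions are added up:
  \<open>n\<^sub>k = a + b\<close> and \<open>x\<^sub>k\<^sub>,\<^sub>k = xkk + xkm + xmm\<close>.
\<close>

definition degree_profile ::
    "'a set \<Rightarrow> 'a set set \<Rightarrow> nat \<Rightarrow> nat \<Rightarrow> real \<Rightarrow> real \<Rightarrow> real \<Rightarrow> real \<Rightarrow> real \<Rightarrow> bool" where
  "degree_profile V E k m a b xkk xkm xmm \<longleftrightarrow>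
     (\<forall>i. real (num_vertices V E i) = (if i = k then a else 0) + (if i = m then b else 0)) \<and>
     (\<forall>i j. i \<le> j \<longrightarrow>
        real (num_edges E i j) =
          (if i = k \<and> j = k then xkk else 0) +
          (if i = k \<and> j = m then xkm else 0) +
          (if i = m \<and> j = m then xmm else 0))"

definition regular_graph :: "nat \<Rightarrow> 'a set \<Rightarrow> 'a set set \<Rightarrow> bool" where
  "regular_graph r V E \<longleftrightarrow> simple_graph V E \<and> (\<forall>v\<in>V. degree E v = r)"

definition complement_edges :: "'a set \<Rightarrow> 'a set set \<Rightarrow> 'a set set" where
  "complement_edges V E = {e. e \<subseteq> V \<and> card e = 2} - E"

text \<open>
  The family $\mathcal{G}_{n,p,k,m}$. The degrees \<open>n - k - 1\<close> and \<open>n - m - 1\<close> use truncated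
  subtraction and have their intended meaning for \<open>k, m < n\<close>.
\<close>

definition complement_family ::
    "nat \<Rightarrow> nat \<Rightarrow> nat \<Rightarrow> nat \<Rightarrow> 'a set \<Rightarrow> 'a set set \<Rightarrow> bool" where
  "complement_family n p k m V E \<longleftrightarrow>
     finite V \<and> card V = n \<and>
     (\<exists>P F1 F2. P \<subseteq> V \<and> card P = p \<and>
        regular_graph (n - k - 1) P F1 \<and>
        regular_graph (n - m - 1) (V - P) F2 \<and>
        E = complement_edges V (F1 \<union> F2))"

end

theory Submission
  imports Defs
begin

text \<open>
  On an edge \<open>uv\<close> the identity \<open>1/max = (1/d(u) + 1/d(v))/2 - (1/min - 1/max)/2\<close> holds, and
  \<open>1/d(u) + 1/d(v)\<close> sums over all edges to the number of vertices of positive degree. Hence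
  \<open>R' = n/2 - S/2\<close>, where \<open>S\<close> adds up the gaps \<open>1/min - 1/max\<close>, and a lower bound for \<open>R'\<close> is an
  upper bound for \<open>S\<close>. Telescoping the gap of an edge into the steps \<open>1/t - 1/(t+1)\<close> with
  \<open>min \<le> t < max\<close> and exchanging the sums gives \<open>S = (\<Sum>t=k..<m. (1/t - 1/(t+1)) * c(t))\<close>, where
  \<open>c(t)\<close> counts the edges that leave the set of the \<open>a(t)\<close> vertices of degree at most \<open>t\<close>
  (\<open>randic_var_eq_gap\<close>, \<open>sum_gap_eq_cuts\<close>).

  Such a cut has at most \<open>a(t) (n - a(t))\<close> edges. Since this is at most \<open>n\<^sup>2/4\<close>, the second bound
  follows at once (\<open>sum_cuts_le_quarter_square\<close>). For the first bound, where \<open>2k \<le> n\<close>, the product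
  is at most \<open>k (n - k)\<close> once \<open>a(t) \<ge> n - k\<close>, which is the case from some threshold \<open>T\<close> on.
  Below \<open>T\<close> the cut is instead bounded by the degree sum of its low side. The steps below \<open>T\<close> that charge a vertex of degree \<open>d < T\<close> add up to \<open>d (1/d - 1/T) \<le> 1 - k/T\<close>, and
  at most \<open>n - k\<close> vertices are charged. The two parts together give exactly
  \<open>(1/k - 1/m) k (n - k)\<close> (\<open>sum_cuts_le_min_degree\<close>).

  Equality holds as soon as all degrees are \<open>k\<close> or \<open>m\<close> and the number of edges between the two
  degree classes is the right one (\<open>randic_var_of_degree_profile\<close>). In a graph of the complement
  family \<open>\<G>\<^bsub>n,p,k,m\<^esub>\<close> the two classes have \<open>p\<close> and \<open>n - p\<close> vertices and are completely joined,
  so all parameters are determined by counting degrees (\<open>complement_family_props\<close>). The extremal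
  graphs of both parts come from this one family: \<open>p = n - k\<close> in the first part, where the
  \<open>(n-k-1)\<close>-regular graph on \<open>p\<close> vertices is complete and hence the degree-\<open>k\<close> vertices are
  independent, and \<open>p = n/2\<close> in the second. The parity conditions are those under which the
  required regular graphs exist; circulant graphs provide them (\<open>ex_regular_graph\<close>).
\<close>

section \<open>Edges and degrees\<close>

lemma finite_edges: "simple_graph V E \<Longrightarrow> finite E"
  by (rule finite_subset[of _ "Pow V"]) (auto simp: simple_graph_def)

lemma simple_graph_edgeE:
  assumes "simple_graph V E" "e \<in> E"
  obtains u v where "e = {u, v}" "u \<noteq> v" "u \<in> V" "v \<in> V"
proof -
  have "card e = 2" "e \<subseteq> V" using assms by (auto simp: simple_graph_def)
  then obtain u v where "e = {u, v}" "u \<noteq> v" by (auto simp: card_2_iff)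
  with \<open>e \<subseteq> V\<close> that show ?thesis by auto
qed

text \<open>
  Double counting of incidences. It is used with the weight \<open>1/d\<close> on all of \<open>V\<close>, where the right-hand
  side becomes the number of vertices, and with the weight \<open>1\<close> on a degree class, where it counts
  edges by the number of their ends in the class.
\<close>

lemma sum_over_edge_ends:
  fixes f :: "'a \<Rightarrow> real"
  assumes "simple_graph V E" "A \<subseteq> V"
  shows "(\<Sum>e\<in>E. \<Sum>v\<in>e \<inter> A. f v) = (\<Sum>v\<in>A. real (degree E v) * f v)"
proof -
  have fin: "finite A" using assms by (auto simp: simple_graph_def intro: finite_subset)
  have "(\<Sum>e\<in>E. \<Sum>v\<in>e \<inter> A. f v) = (\<Sum>e\<in>E. sum f {v\<in>A. v \<in> e})"
    by (intro sum.cong refl) auto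
  also have "\<dots> = (\<Sum>v\<in>A. sum (\<lambda>e. f v) {e\<in>E. v \<in> e})"
    by (rule sum.swap_restrict[OF finite_edges[OF assms(1)] fin])
  finally show ?thesis by (simp add: degree_def)
qed

lemma degree_eq_card_neighbours:
  assumes "simple_graph V E" "w \<in> V"
  shows "degree E w = card {v\<in>V. {w, v} \<in> E}"
proof -
  have "bij_betw (\<lambda>v. {w, v}) {v\<in>V. {w, v} \<in> E} {e\<in>E. w \<in> e}"
    unfolding bij_betw_def
  proof
    show "inj_on (\<lambda>v. {w, v}) {v\<in>V. {w, v} \<in> E}"
      by (auto simp: inj_on_def doubleton_eq_iff)
    show "(\<lambda>v. {w, v}) ` {v\<in>V. {w, v} \<in> E} = {e\<in>E. w \<in> e}"
    proof (intro equalityI subsetI)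
      fix e assume e: "e \<in> {e\<in>E. w \<in> e}"
      then obtain u v where uv: "e = {u, v}" "u \<in> V" "v \<in> V"
        using simple_graph_edgeE[OF assms(1), of e] by blast
      show "e \<in> (\<lambda>v. {w, v}) ` {v\<in>V. {w, v} \<in> E}"
      proof (cases "w = u")
        case True then show ?thesis using uv e by auto
      next
        case False
        then have "e = {w, u}" using uv e by auto
        then show ?thesis using uv e by auto
      qed
    qed auto
  qed
  then show ?thesis by (simp add: degree_def bij_betw_same_card)
qed

lemma bounded_degree_graph_iff:
  assumes "0 < n"
  shows "bounded_degree_graph n k m V E \<longleftrightarrow>
    simple_graph V E \<and> card V = n \<and> (\<forall>v\<in>V. k \<le> degree E v \<and> degree E v \<le> m)"
proof (cases "simple_graph V E \<and> card V = n")
  case True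
  then have "finite V" "V \<noteq> {}" using assms by (auto simp: simple_graph_def)
  then show ?thesis
    using True by (auto simp: bounded_degree_graph_def min_degree_def max_degree_def)
qed (auto simp: bounded_degree_graph_def)

section \<open>The index as a sum over degree cuts\<close>

definition edge_gap :: "'a set set \<Rightarrow> 'a set \<Rightarrow> real" where
  "edge_gap E e = 1 / real (Min (degree E ` e)) - 1 / real (Max (degree E ` e))"

lemma randic_var_eq_gap:
  assumes "simple_graph V E" "\<forall>v\<in>V. 0 < degree E v"
  shows "randic_var E = real (card V) / 2 - 1 / 2 * (\<Sum>e\<in>E. edge_gap E e)"
proof -
  have "1 / real (Max (degree E ` e)) = 1 / 2 * (\<Sum>v\<in>e \<inter> V. 1 / real (degree E v)) - 1 / 2 * edge_gap E e"
    if e: "e \<in> E" for e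
  proof -
    obtain u v where uv: "e = {u, v}" "u \<noteq> v" "u \<in> V" "v \<in> V"
      using simple_graph_edgeE[OF assms(1) e] .
    then have "e \<inter> V = {u, v}" by auto
    with uv show ?thesis
      by (cases "degree E u \<le> degree E v") (simp_all add: edge_gap_def max_def min_def field_simps)
  qed
  then have "randic_var E = 1 / 2 * (\<Sum>e\<in>E. \<Sum>v\<in>e \<inter> V. 1 / real (degree E v)) - 1 / 2 * (\<Sum>e\<in>E. edge_gap E e)"
    by (simp add: randic_var_def sum_subtractf sum_distrib_left)
  also have "(\<Sum>e\<in>E. \<Sum>v\<in>e \<inter> V. 1 / real (degree E v)) = (\<Sum>v\<in>V. real (degree E v) * (1 / real (degree E v)))"
    by (rule sum_over_edge_ends[OF assms(1) order_refl])
  also have "\<dots> = (\<Sum>v\<in>V. 1)" using assms(2) by (intro sum.cong) auto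
  finally show ?thesis by simp
qed

text \<open>The sums of this weight over \<open>[a, b)\<close> telescope to \<open>1/a - 1/b\<close>, which is the gap of an edge
  with end degrees \<open>a \<le> b\<close>.\<close>

definition step_weight :: "nat \<Rightarrow> real" where
  "step_weight t = 1 / real t - 1 / real (Suc t)"

lemma step_weight_nonneg: "0 < t \<Longrightarrow> 0 \<le> step_weight t"
  by (simp add: step_weight_def field_simps)

lemma sum_step_weight: "a \<le> b \<Longrightarrow> (\<Sum>t=a..<b. step_weight t) = 1 / real a - 1 / real b"
  using sum_Suc_diff'[of a b "\<lambda>t. - (1 / real t)"] by (simp add: step_weight_def)

definition low_vertices :: "'a set \<Rightarrow> 'a set set \<Rightarrow> nat \<Rightarrow> 'a set" where
  "low_vertices V E t = {v\<in>V. degree E v \<le> t}"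

definition cut_edges :: "'a set set \<Rightarrow> nat \<Rightarrow> 'a set set" where
  "cut_edges E t = {e\<in>E. Min (degree E ` e) \<le> t \<and> t < Max (degree E ` e)}"

text \<open>
  An edge contributes the weight of \<open>t\<close> exactly when \<open>t\<close> separates its end degrees, so exchanging the
  sums over edges and thresholds leaves the size of one cut per threshold.
\<close>

lemma sum_gap_eq_cuts:
  assumes "simple_graph V E" "\<forall>v\<in>V. k \<le> degree E v \<and> degree E v \<le> m"
  shows "(\<Sum>e\<in>E. edge_gap E e) = (\<Sum>t=k..<m. step_weight t * real (card (cut_edges E t)))"
proof -
  have "edge_gap E e = sum step_weight {t\<in>{k..<m}. Min (degree E ` e) \<le> t \<and> t < Max (degree E ` e)}"
    if e: "e \<in> E" for e
  proof -
    obtain u v where uv: "e = {u, v}" "u \<in> V" "v \<in> V"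
      using simple_graph_edgeE[OF assms(1) e] .
    then have "k \<le> Min (degree E ` e)" "Max (degree E ` e) \<le> m" "Min (degree E ` e) \<le> Max (degree E ` e)"
      using assms(2) by (auto simp: min_le_iff_disj le_max_iff_disj)
    moreover from this have "{t\<in>{k..<m}. Min (degree E ` e) \<le> t \<and> t < Max (degree E ` e)}
        = {Min (degree E ` e)..<Max (degree E ` e)}"
      by auto
    ultimately show ?thesis by (simp add: edge_gap_def sum_step_weight)
  qed
  then have "(\<Sum>e\<in>E. edge_gap E e) =
      (\<Sum>e\<in>E. sum step_weight {t\<in>{k..<m}. Min (degree E ` e) \<le> t \<and> t < Max (degree E ` e)})"
    by simp
  also have "\<dots> = (\<Sum>t=k..<m. sum (\<lambda>e. step_weight t) (cut_edges E t))"
    unfolding cut_edges_def by (rule sum.swap_restrict) (simp_all add: finite_edges[OF assms(1)])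
  finally show ?thesis by (simp add: mult.commute)
qed

lemma cut_edgeE:
  assumes "simple_graph V E" "e \<in> cut_edges E t"
  obtains u v where "e = {u, v}" "u \<in> low_vertices V E t" "v \<in> V - low_vertices V E t"
proof -
  have "e \<in> E" using assms(2) by (simp add: cut_edges_def)
  then obtain u v where uv: "e = {u, v}" "u \<in> V" "v \<in> V"
    using simple_graph_edgeE[OF assms(1)] by metis
  consider "degree E u \<le> t" "t < degree E v" | "degree E v \<le> t" "t < degree E u"
    using assms(2) uv by (force simp: cut_edges_def min_le_iff_disj less_max_iff_disj)
  then show ?thesis
  proof cases
    case 1 then show ?thesis using that[of u v] uv by (auto simp: low_vertices_def)
  next
    case 2 then show ?thesis using that[of v u] uv by (auto simp: low_vertices_def)
  qed
qed

lemma card_cut_le_product: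
  assumes "simple_graph V E"
  shows "real (card (cut_edges E t)) \<le> real (card (low_vertices V E t)) * (real (card V) - real (card (low_vertices V E t)))"
proof -
  let ?A = "low_vertices V E t"
  have fin: "finite V" using assms by (simp add: simple_graph_def)
  have sub: "?A \<subseteq> V" by (auto simp: low_vertices_def)
  have finA: "finite ?A" by (rule finite_subset[OF sub fin])
  have "cut_edges E t \<subseteq> (\<lambda>(u, v). {u, v}) ` (?A \<times> (V - ?A))"
    by (rule subsetI, erule cut_edgeE[OF assms]) (auto simp: image_iff)
  then have "card (cut_edges E t) \<le> card (?A \<times> (V - ?A))"
    by (rule surj_card_le[rotated]) (simp add: fin finA)
  also have "\<dots> = card ?A * (card V - card ?A)"
    using card_Diff_subset[OF finA sub] by (simp add: card_cartesian_product)
  finally have "real (card (cut_edges E t)) \<le> real (card ?A * (card V - card ?A))"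
    by (simp only: of_nat_le_iff)
  then show ?thesis using card_mono[OF fin sub] by (simp add: of_nat_diff)
qed

text \<open>
  Every cut edge uses up one unit of degree at its low end. This beats the product
  bound when the degrees on the low side are below the number of vertices on the high side.
\<close>

lemma card_cut_le_degree_sum:
  assumes "simple_graph V E"
  shows "card (cut_edges E t) \<le> (\<Sum>v\<in>low_vertices V E t. degree E v)"
proof -
  have fin: "finite V" using assms by (simp add: simple_graph_def)
  have finA: "finite (low_vertices V E t)" using fin by (simp add: low_vertices_def)
  have "cut_edges E t \<subseteq> (\<Union>v\<in>low_vertices V E t. {e\<in>E. v \<in> e})"
  proof
    fix e assume e: "e \<in> cut_edges E t"
    then have "e \<in> E" by (simp add: cut_edges_def)
    then show "e \<in> (\<Union>v\<in>low_vertices V E t. {e\<in>E. v \<in> e})"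
      using cut_edgeE[OF assms e] by blast
  qed
  then have "card (cut_edges E t) \<le> card (\<Union>v\<in>low_vertices V E t. {e\<in>E. v \<in> e})"
    by (rule card_mono[rotated]) (simp add: finA finite_edges[OF assms])
  also have "\<dots> \<le> (\<Sum>v\<in>low_vertices V E t. degree E v)"
    unfolding degree_def by (rule card_UN_le[OF finA])
  finally show ?thesis .
qed

section \<open>The two lower bounds\<close>

lemma sum_cuts_le_quarter_square:
  assumes "simple_graph V E" "0 < k" "k \<le> m"
  shows "(\<Sum>t=k..<m. step_weight t * real (card (cut_edges E t)))
    \<le> (1 / real k - 1 / real m) * ((real (card V))\<^sup>2 / 4)"
proof -
  have "step_weight t * real (card (cut_edges E t)) \<le> step_weight t * ((real (card V))\<^sup>2 / 4)" if "t \<in> {k..<m}" for t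
  proof (rule mult_left_mono)
    let ?a = "real (card (low_vertices V E t))"
    have "real (card (cut_edges E t)) \<le> ?a * (real (card V) - ?a)"
      by (rule card_cut_le_product[OF assms(1)])
    also have "\<dots> \<le> (real (card V))\<^sup>2 / 4"
      using zero_le_power2[of "real (card V) - 2 * ?a"] by (simp add: power2_eq_square algebra_simps)
    finally show "real (card (cut_edges E t)) \<le> (real (card V))\<^sup>2 / 4" .
  qed (use that assms(2) in \<open>simp add: step_weight_nonneg\<close>)
  then have "(\<Sum>t=k..<m. step_weight t * real (card (cut_edges E t))) \<le> (\<Sum>t=k..<m. step_weight t * ((real (card V))\<^sup>2 / 4))"
    by (rule sum_mono)
  also have "\<dots> = (1 / real k - 1 / real m) * ((real (card V))\<^sup>2 / 4)"
    by (simp only: sum_distrib_right[symmetric] sum_step_weight[OF assms(3)])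
  finally show ?thesis .
qed

text \<open>
  A vertex of degree \<open>d\<close> lies on the low side of the cuts at \<open>t = d, \<dots>, T - 1\<close>, and is charged \<open>d\<close> times
  the weight each time. The charges telescope to \<open>d (1/d - 1/T) = 1 - d/T\<close>, which is largest for
  \<open>d = k\<close>.
\<close>

lemma sum_low_cuts_le:
  assumes "simple_graph V E" "\<forall>v\<in>V. k \<le> degree E v" "0 < k" "k \<le> T"
  shows "(\<Sum>t=k..<T. step_weight t * real (card (cut_edges E t)))
    \<le> real (card {v\<in>V. degree E v < T}) * (1 - real k / real T)"
proof -
  let ?L = "{v\<in>V. degree E v < T}"
  have fin: "finite ?L" using assms(1) by (simp add: simple_graph_def)
  have "(\<Sum>t=k..<T. step_weight t * real (card (cut_edges E t)))
      \<le> (\<Sum>t=k..<T. \<Sum>v | v \<in> ?L \<and> degree E v \<le> t. step_weight t * real (degree E v))"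
  proof (rule sum_mono)
    fix t assume t: "t \<in> {k..<T}"
    then have "{v. v \<in> ?L \<and> degree E v \<le> t} = low_vertices V E t" by (auto simp: low_vertices_def)
    moreover have "step_weight t * real (card (cut_edges E t)) \<le> step_weight t * real (\<Sum>v\<in>low_vertices V E t. degree E v)"
      using t assms(3) card_cut_le_degree_sum[OF assms(1), of t]
      by (intro mult_left_mono) (simp_all only: of_nat_le_iff, simp_all add: step_weight_nonneg)
    ultimately show "step_weight t * real (card (cut_edges E t)) \<le> (\<Sum>v | v \<in> ?L \<and> degree E v \<le> t. step_weight t * real (degree E v))"
      by (simp add: sum_distrib_left)
  qed
  also have "\<dots> = (\<Sum>v\<in>?L. \<Sum>t | t \<in> {k..<T} \<and> degree E v \<le> t. step_weight t * real (degree E v))"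
    by (rule sum.swap_restrict) (simp_all add: fin del: mem_Collect_eq)
  also have "\<dots> \<le> (\<Sum>v\<in>?L. 1 - real k / real T)"
  proof (rule sum_mono)
    fix v assume v: "v \<in> ?L"
    then have d: "k \<le> degree E v" "degree E v < T" using assms(2) by auto
    then have "{t. t \<in> {k..<T} \<and> degree E v \<le> t} = {degree E v..<T}" by auto
    then have "(\<Sum>t | t \<in> {k..<T} \<and> degree E v \<le> t. step_weight t * real (degree E v))
        = (1 / real (degree E v) - 1 / real T) * real (degree E v)"
      using d by (simp only: sum_distrib_right[symmetric] sum_step_weight less_imp_le)
    also have "\<dots> = 1 - real (degree E v) / real T" using d assms(3) by (simp add: field_simps)
    also have "\<dots> \<le> 1 - real k / real T" using d by (simp add: divide_right_mono)
    finally show "(\<Sum>t | t \<in> {k..<T} \<and> degree E v \<le> t. step_weight t * real (degree E v)) \<le> 1 - real k / real T" .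
  qed
  finally show ?thesis by simp
qed

text \<open>
  A single cut may well have more than \<open>k (n - k)\<close> edges, up to \<open>n\<^sup>2/4\<close> when its sides are balanced, so
  the bound cannot be proved threshold by threshold. The proof changes from the degree bound to the
  product bound at the first threshold at which all but at most \<open>k\<close> vertices are low.
\<close>

lemma sum_cuts_le_min_degree:
  assumes "simple_graph V E" "\<forall>v\<in>V. k \<le> degree E v \<and> degree E v \<le> m"
    and "0 < k" "k \<le> m" and half: "2 * k \<le> card V"
  shows "(\<Sum>t=k..<m. step_weight t * real (card (cut_edges E t)))
    \<le> (1 / real k - 1 / real m) * (real k * (real (card V) - real k))"
proof -
  let ?n = "card V"
  have fin: "finite V" using assms(1) by (simp add: simple_graph_def)
  define T where "T = (LEAST t. k \<le> t \<and> ?n - k \<le> card (low_vertices V E t))"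
  have "low_vertices V E m = V" using assms(2) by (auto simp: low_vertices_def)
  then have m: "k \<le> m \<and> ?n - k \<le> card (low_vertices V E m)" using assms(4) by simp
  have T: "k \<le> T" "?n - k \<le> card (low_vertices V E T)"
    using LeastI[of "\<lambda>t. k \<le> t \<and> ?n - k \<le> card (low_vertices V E t)", OF m] by (simp_all add: T_def)
  have Tm: "T \<le> m" unfolding T_def by (rule Least_le[where P = "\<lambda>t. k \<le> t \<and> ?n - k \<le> card (low_vertices V E t)", OF m])
  \<comment> \<open>By minimality \<open>T - 1\<close> falls short of \<open>n - k\<close> low vertices, unless \<open>T\<close> is already \<open>k\<close>.\<close>
  have few: "card {v\<in>V. degree E v < T} \<le> ?n - k"
  proof (cases "T = k")
    case True
    then have none: "{v\<in>V. degree E v < T} = {}" using assms(2) by fastforce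
    show ?thesis unfolding none by simp
  next
    case False
    then have "\<not> (k \<le> T - 1 \<and> ?n - k \<le> card (low_vertices V E (T - 1)))"
      using T(1) unfolding T_def by (intro not_less_Least) auto
    moreover have "{v\<in>V. degree E v < T} = low_vertices V E (T - 1)" using False T(1) by (auto simp: low_vertices_def)
    ultimately show ?thesis using False T(1) by auto
  qed
  have "(\<Sum>t=k..<T. step_weight t * real (card (cut_edges E t))) \<le> real (card {v\<in>V. degree E v < T}) * (1 - real k / real T)"
    using assms T(1) by (intro sum_low_cuts_le) auto
  also have "\<dots> \<le> real (?n - k) * (1 - real k / real T)"
    using few T(1) assms(3) by (intro mult_right_mono) (simp_all add: field_simps)
  finally have below: "(\<Sum>t=k..<T. step_weight t * real (card (cut_edges E t))) \<le> (real ?n - real k) * (1 - real k / real T)"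
    using half by (simp add: of_nat_diff)
  have "(\<Sum>t=T..<m. step_weight t * real (card (cut_edges E t))) \<le> (\<Sum>t=T..<m. step_weight t * (real k * (real ?n - real k)))"
  proof (intro sum_mono mult_left_mono)
    fix t assume t: "t \<in> {T..<m}"
    let ?a = "real (card (low_vertices V E t))"
    have "low_vertices V E T \<subseteq> low_vertices V E t" "finite (low_vertices V E t)" using t fin by (auto simp: low_vertices_def)
    then have "?n - k \<le> card (low_vertices V E t)" using T(2) card_mono order_trans by blast
    then have a: "real ?n - real k \<le> ?a" using half by linarith
    have "real (card (cut_edges E t)) \<le> ?a * (real ?n - ?a)"
      by (rule card_cut_le_product[OF assms(1)])
    also have "\<dots> \<le> real k * (real ?n - real k)"
    proof -
      have "0 \<le> (?a - (real ?n - real k)) * (?a - real k)"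
        using a half by (intro mult_nonneg_nonneg) linarith+
      then show ?thesis by (simp add: algebra_simps)
    qed
    finally show "real (card (cut_edges E t)) \<le> real k * (real ?n - real k)" .
    show "0 \<le> step_weight t" using t T(1) assms(3) by (simp add: step_weight_nonneg)
  qed
  also have "\<dots> = (1 / real T - 1 / real m) * (real k * (real ?n - real k))"
    by (simp only: sum_distrib_right[symmetric] sum_step_weight[OF Tm])
  finally have above: "(\<Sum>t=T..<m. step_weight t * real (card (cut_edges E t)))
      \<le> (1 / real T - 1 / real m) * (real k * (real ?n - real k))" .
  have "(\<Sum>t=k..<m. step_weight t * real (card (cut_edges E t)))
      = (\<Sum>t=k..<T. step_weight t * real (card (cut_edges E t))) + (\<Sum>t=T..<m. step_weight t * real (card (cut_edges E t)))"
    using T(1) Tm by (simp add: sum.atLeastLessThan_concat)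
  also have "\<dots> \<le> (real ?n - real k) * (1 - real k / real T)
      + (1 / real T - 1 / real m) * (real k * (real ?n - real k))"
    using below above by (rule add_mono)
  also have "\<dots> = (1 / real k - 1 / real m) * (real k * (real ?n - real k))"
    using assms(3,4) T(1) by (simp add: field_simps)
  finally show ?thesis .
qed

lemma randic_var_lower_bounds:
  assumes "bounded_degree_graph n k m V E" "0 < k" "k \<le> m" "0 < n"
  shows "real n / 2 - 1 / 2 * (1 / real k - 1 / real m) * ((real n)\<^sup>2 / 4) \<le> randic_var E"
    and "2 * k \<le> n \<Longrightarrow>
      real n / 2 - 1 / 2 * (1 / real k - 1 / real m) * (real k * (real n - real k)) \<le> randic_var E"
proof -
  have G: "simple_graph V E" "card V = n" "\<forall>v\<in>V. k \<le> degree E v \<and> degree E v \<le> m"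
    using assms(1) unfolding bounded_degree_graph_iff[OF assms(4)] by blast+
  have pos: "\<forall>v\<in>V. 0 < degree E v" using G(3) assms(2) by fastforce
  have R: "randic_var E = real n / 2 - 1 / 2 * (\<Sum>t=k..<m. step_weight t * real (card (cut_edges E t)))"
    using randic_var_eq_gap[OF G(1) pos] sum_gap_eq_cuts[OF G(1,3)] G(2) by simp
  show "real n / 2 - 1 / 2 * (1 / real k - 1 / real m) * ((real n)\<^sup>2 / 4) \<le> randic_var E"
    using sum_cuts_le_quarter_square[OF G(1) assms(2,3)] G(2) R by simp
  show "real n / 2 - 1 / 2 * (1 / real k - 1 / real m) * (real k * (real n - real k)) \<le> randic_var E"
    if "2 * k \<le> n"
    using sum_cuts_le_min_degree[OF G(1,3) assms(2,3)] that G(2) R by simp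
qed

section \<open>Graphs with two degrees\<close>

text \<open>
  For \<open>i \<le> j\<close> the unordered pair of end degrees is determined by its minimum and maximum; in this form
  the edge counts can be compared with the gaps.
\<close>

lemma num_edges_eq_Min_Max:
  assumes "simple_graph V E" "i \<le> j"
  shows "num_edges E i j = card {e\<in>E. Min (degree E ` e) = i \<and> Max (degree E ` e) = j}"
proof -
  have "(\<exists>u v. e = {u, v} \<and> degree E u = i \<and> degree E v = j) \<longleftrightarrow>
      Min (degree E ` e) = i \<and> Max (degree E ` e) = j" if e: "e \<in> E" for e
  proof
    assume "Min (degree E ` e) = i \<and> Max (degree E ` e) = j"
    moreover obtain u v where "e = {u, v}" using simple_graph_edgeE[OF assms(1) e] .
    ultimately show "\<exists>u v. e = {u, v} \<and> degree E u = i \<and> degree E v = j"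
      by (cases "degree E u \<le> degree E v") (auto simp: min_def max_def)
  qed (use assms(2) in auto)
  then have "{e\<in>E. \<exists>u v. e = {u, v} \<and> degree E u = i \<and> degree E v = j} =
      {e\<in>E. Min (degree E ` e) = i \<and> Max (degree E ` e) = j}"
    by (intro Collect_cong conj_cong refl)
  then show ?thesis by (simp only: num_edges_def)
qed

text \<open>
  Only edges between the two degree classes have a nonzero gap. For \<open>k = m\<close>, where the profile does not
  determine \<open>xkm\<close>, its coefficient vanishes.
\<close>

lemma randic_var_of_degree_profile:
  assumes G: "simple_graph V E" and prof: "degree_profile V E k m a b xkk xkm xmm"
    and "0 < k" "k \<le> m"
  shows "randic_var E = real (card V) / 2 - 1 / 2 * (1 / real k - 1 / real m) * xkm"
proof -
  have deg: "degree E v = k \<or> degree E v = m" if "v \<in> V" for v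
  proof (rule ccontr)
    assume "\<not> ?thesis"
    then have "real (num_vertices V E (degree E v)) = 0"
      using prof by (simp add: degree_profile_def)
    moreover have "finite V" using G by (simp add: simple_graph_def)
    ultimately show False using that by (auto simp: num_vertices_def)
  qed
  let ?X = "{e\<in>E. Min (degree E ` e) = k \<and> Max (degree E ` e) = m}"
  have "edge_gap E e = (if e \<in> ?X then 1 / real k - 1 / real m else 0)" if e: "e \<in> E" for e
  proof -
    obtain u v where uv: "e = {u, v}" "u \<in> V" "v \<in> V"
      using simple_graph_edgeE[OF G e] .
    then show ?thesis using deg[of u] deg[of v] assms(4) e
      by (auto simp: edge_gap_def min_def max_def)
  qed
  then have "(\<Sum>e\<in>E. edge_gap E e) = (\<Sum>e\<in>E. if e \<in> ?X then 1 / real k - 1 / real m else 0)"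
    by simp
  also have "\<dots> = (\<Sum>e\<in>E \<inter> ?X. 1 / real k - 1 / real m)"
    by (rule sum.inter_restrict[OF finite_edges[OF G], symmetric])
  also have "E \<inter> ?X = ?X" by auto
  also have "(\<Sum>e\<in>?X. 1 / real k - 1 / real m) = (1 / real k - 1 / real m) * real (num_edges E k m)"
    by (simp add: num_edges_eq_Min_Max[OF G assms(4)])
  also have "\<dots> = (1 / real k - 1 / real m) * xkm"
  proof (cases "k = m")
    case False
    then have "real (num_edges E k m) = xkm" using prof assms(4) by (simp add: degree_profile_def)
    then show ?thesis by simp
  qed simp
  finally have "(\<Sum>e\<in>E. edge_gap E e) = (1 / real k - 1 / real m) * xkm" .
  moreover have "\<forall>v\<in>V. 0 < degree E v" using deg assms(3,4) by fastforce
  ultimately show ?thesis using randic_var_eq_gap[OF G] by simp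
qed

text \<open>
  The degree sum over \<open>P\<close> counts the edges inside \<open>P\<close> twice and the edges leaving \<open>P\<close> once. When the
  number of leaving edges is known, this gives the number of edges inside.
\<close>

lemma card_edges_between_degree_classes:
  assumes G: "simple_graph V E" and P: "P \<subseteq> V" and deg: "\<forall>v\<in>P. degree E v = d"
  shows "real d * real (card P) = 2 * real (card {e\<in>E. e \<subseteq> P}) + real (card {e\<in>E. \<not> e \<subseteq> P \<and> \<not> e \<subseteq> V - P})"
proof -
  have finE: "finite E" by (rule finite_edges[OF G])
  let ?in = "{e\<in>E. e \<subseteq> P}" and ?x = "{e\<in>E. \<not> e \<subseteq> P \<and> \<not> e \<subseteq> V - P}"
  have "real d * real (card P) = (\<Sum>v\<in>P. real (degree E v) * 1)" using deg by simp
  also have "\<dots> = (\<Sum>e\<in>E. \<Sum>v\<in>e \<inter> P. 1)"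
    by (rule sum_over_edge_ends[OF G P, symmetric])
  also have "\<dots> = (\<Sum>e\<in>E. (if e \<in> ?in then 2 else 0) + (if e \<in> ?x then 1 else 0))"
  proof (rule sum.cong[OF refl])
    fix e assume e: "e \<in> E"
    obtain u v where uv: "e = {u, v}" "u \<noteq> v" "u \<in> V" "v \<in> V"
      using simple_graph_edgeE[OF G e] .
    show "(\<Sum>v\<in>e \<inter> P. 1) = (if e \<in> ?in then 2 else 0) + (if e \<in> ?x then 1 else (0::real))"
      using e uv P by (cases "u \<in> P"; cases "v \<in> P") auto
  qed
  also have "\<dots> = (\<Sum>e\<in>E. if e \<in> ?in then 2 else 0) + (\<Sum>e\<in>E. if e \<in> ?x then 1 else 0)"
    by (rule sum.distrib)
  also have "(\<Sum>e\<in>E. if e \<in> ?in then 2 else (0::real)) = (\<Sum>e\<in>E \<inter> ?in. 2)"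
    by (rule sum.inter_restrict[OF finE, symmetric])
  also have "(\<Sum>e\<in>E. if e \<in> ?x then 1 else (0::real)) = (\<Sum>e\<in>E \<inter> ?x. 1)"
    by (rule sum.inter_restrict[OF finE, symmetric])
  also have "E \<inter> ?in = ?in" by auto
  also have "E \<inter> ?x = ?x" by auto
  finally show ?thesis by simp
qed

text \<open>
  The three edge classes are taken relative to \<open>P\<close> and not to the degrees, so that they stay disjoint
  for \<open>k = m\<close>, where the profile adds up their contributions.
\<close>

lemma degree_profile_two_classes:
  assumes G: "simple_graph V E" and P: "P \<subseteq> V" and "k \<le> m"
    and degP: "\<forall>v\<in>P. degree E v = k" and degQ: "\<forall>v\<in>V - P. degree E v = m"
  shows "degree_profile V E k m (real (card P)) (real (card (V - P)))
    (real (card {e\<in>E. e \<subseteq> P})) (real (card {e\<in>E. \<not> e \<subseteq> P \<and> \<not> e \<subseteq> V - P}))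
    (real (card {e\<in>E. e \<subseteq> V - P}))"
  unfolding degree_profile_def
proof (intro conjI allI impI)
  have fin: "finite V" "finite E" using G finite_edges[OF G] by (auto simp: simple_graph_def)
  have finP: "finite P" by (rule finite_subset[OF P fin(1)])
  fix i
  have classes: "{v\<in>V. degree E v = i} = (if i = k then P else {}) \<union> (if i = m then V - P else {})"
    using degP degQ P by auto
  then show "real (num_vertices V E i) = (if i = k then real (card P) else 0) + (if i = m then real (card (V - P)) else 0)"
    unfolding num_vertices_def classes using fin finP
    by (subst card_Un_disjoint) auto
  fix j :: nat assume "i \<le> j"
  let ?A = "{e\<in>E. e \<subseteq> P}" and ?B = "{e\<in>E. \<not> e \<subseteq> P \<and> \<not> e \<subseteq> V - P}" and ?C = "{e\<in>E. e \<subseteq> V - P}"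
  have mm: "(Min (degree E ` e) = i \<and> Max (degree E ` e) = j) \<longleftrightarrow>
      e \<in> ?A \<and> i = k \<and> j = k \<or> e \<in> ?B \<and> i = k \<and> j = m \<or> e \<in> ?C \<and> i = m \<and> j = m"
    if e: "e \<in> E" for e
  proof -
    obtain u v where uv: "e = {u, v}" "u \<noteq> v" "u \<in> V" "v \<in> V"
      using simple_graph_edgeE[OF G e] .
    have du: "degree E u = (if u \<in> P then k else m)" and dv: "degree E v = (if v \<in> P then k else m)"
      using uv degP degQ by auto
    show ?thesis using e uv du dv \<open>k \<le> m\<close> by (cases "u \<in> P"; cases "v \<in> P") auto
  qed
  have eq: "{e\<in>E. Min (degree E ` e) = i \<and> Max (degree E ` e) = j} =
      (if i = k \<and> j = k then ?A else {}) \<union> ((if i = k \<and> j = m then ?B else {}) \<union> (if i = m \<and> j = m then ?C else {}))"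
    (is "_ = ?X \<union> (?Y \<union> ?Z)")
  proof (rule set_eqI)
    fix e
    show "e \<in> {e\<in>E. Min (degree E ` e) = i \<and> Max (degree E ` e) = j} \<longleftrightarrow> e \<in> ?X \<union> (?Y \<union> ?Z)"
      using mm[of e] by (cases "e \<in> E") simp_all
  qed
  have "{} \<notin> E" using G by (auto simp: simple_graph_def)
  then have "\<not> e \<subseteq> V - P" if "e \<in> E" "e \<subseteq> P" for e
    using that by (cases "e = {}") auto
  then have disj: "?A \<inter> ?B = {}" "?A \<inter> ?C = {}" "?B \<inter> ?C = {}" by auto
  have "?Y \<inter> ?Z = {}" "?X \<inter> (?Y \<union> ?Z) = {}"
    using disj by (simp_all add: Int_Un_distrib)
  moreover have "finite ?X" "finite ?Y" "finite ?Z" using fin(2) by simp_all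
  ultimately have "card (?X \<union> (?Y \<union> ?Z)) = card ?X + (card ?Y + card ?Z)"
    by (simp only: card_Un_disjoint finite_Un)
  then show "real (num_edges E i j) =
      (if i = k \<and> j = k then real (card ?A) else 0) + (if i = k \<and> j = m then real (card ?B) else 0)
      + (if i = m \<and> j = m then real (card ?C) else 0)"
    unfolding num_edges_eq_Min_Max[OF G \<open>i \<le> j\<close>] eq by simp
qed

section \<open>The complement family\<close>

lemma degree_complement_edges:
  assumes F: "simple_graph V F" and v: "v \<in> V"
  shows "degree (complement_edges V F) v = card V - 1 - degree F v"
proof -
  have G: "simple_graph V (complement_edges V F)"
    using F by (auto simp: simple_graph_def complement_edges_def)
  have fin: "finite V" using F by (simp add: simple_graph_def)
  let ?N = "{u\<in>V. {v, u} \<in> F}"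
  have sub: "?N \<subseteq> V - {v}" using F by (auto simp: simple_graph_def)
  have "{u\<in>V. {v, u} \<in> complement_edges V F} = (V - {v}) - ?N"
    using v by (auto simp: complement_edges_def card_2_iff)
  then have "degree (complement_edges V F) v = card ((V - {v}) - ?N)"
    using degree_eq_card_neighbours[OF G v] by simp
  also have "\<dots> = card (V - {v}) - card ?N"
    using sub fin by (intro card_Diff_subset) auto
  finally show ?thesis using degree_eq_card_neighbours[OF F v] v fin by simp
qed

lemma degree_union_disjoint:
  assumes "\<forall>e\<in>F'. v \<notin> e"
  shows "degree (F \<union> F') v = degree F v"
proof -
  have "{e \<in> F \<union> F'. v \<in> e} = {e\<in>F. v \<in> e}" using assms by auto
  then show ?thesis by (simp add: degree_def)
qed

text \<open>
  Complementation turns the prescribed regular degrees into \<open>k\<close> and \<open>m\<close> and puts in all \<open>p (n - p)\<close>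
  edges between the two sides, since neither regular graph has such an edge. The numbers of edges
  inside the sides then follow from the degree sums.
\<close>

lemma complement_family_props:
  assumes fam: "complement_family n p k m V E" and "0 < k" "k \<le> m" "m < n"
  shows "bounded_degree_graph n k m V E" (is ?bdd)
    and "degree_profile V E k m (real p) (real n - real p)
      (real p * (real p + real k - real n) / 2) (real p * (real n - real p))
      ((real n - real p) * (real m - real p) / 2)" (is ?prof)
    and "randic_var E = real n / 2 - 1 / 2 * (1 / real k - 1 / real m) * (real p * (real n - real p))"
proof -
  from fam obtain P F1 F2 where V: "finite V" "card V = n" and P: "P \<subseteq> V" "card P = p"
    and F1: "simple_graph P F1" "\<forall>v\<in>P. degree F1 v = n - k - 1"
    and F2: "simple_graph (V - P) F2" "\<forall>v\<in>V - P. degree F2 v = n - m - 1"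
    and E: "E = complement_edges V (F1 \<union> F2)"
    unfolding complement_family_def regular_graph_def by blast
  let ?Q = "V - P"
  have finP: "finite P" by (rule finite_subset[OF P(1) V(1)])
  have pn: "p \<le> n" using card_mono[OF V(1) P(1)] V P by simp
  have cQ: "real (card ?Q) = real n - real p"
    using card_Diff_subset[OF finP P(1)] V P pn by (simp add: of_nat_diff)
  have F: "simple_graph V (F1 \<union> F2)"
    using F1(1) F2(1) V(1) P(1) by (auto simp: simple_graph_def)
  have G: "simple_graph V E"
    using V(1) by (auto simp: simple_graph_def complement_edges_def E)
  have degP: "\<forall>v\<in>P. degree E v = k"
  proof
    fix v assume v: "v \<in> P"
    have "\<forall>e\<in>F2. v \<notin> e" using F2(1) v by (auto simp: simple_graph_def)
    then have "degree (F1 \<union> F2) v = n - k - 1"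
      using degree_union_disjoint[of F2 v F1] F1(2) v by simp
    then show "degree E v = k"
      using degree_complement_edges[OF F, of v] v P(1) V(2) assms(3,4) by (auto simp: E)
  qed
  have degQ: "\<forall>v\<in>?Q. degree E v = m"
  proof
    fix v assume v: "v \<in> ?Q"
    have "\<forall>e\<in>F1. v \<notin> e" using F1(1) v by (auto simp: simple_graph_def)
    then have "degree (F2 \<union> F1) v = n - m - 1"
      using degree_union_disjoint[of F1 v F2] F2(2) v by simp
    then show "degree E v = m"
      using degree_complement_edges[OF F, of v] v P(1) V(2) assms(3,4) by (auto simp: E Un_commute)
  qed
  have "k \<le> degree E v \<and> degree E v \<le> m" if "v \<in> V" for v
    using that degP degQ assms(3) by (cases "v \<in> P") auto
  then show ?bdd
    using G V(2) assms(4) by (simp add: bounded_degree_graph_iff)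
  let ?A = "{e\<in>E. e \<subseteq> P}" and ?B = "{e\<in>E. \<not> e \<subseteq> P \<and> \<not> e \<subseteq> ?Q}" and ?C = "{e\<in>E. e \<subseteq> ?Q}"
  have "?B = (\<lambda>(u, v). {u, v}) ` (P \<times> ?Q)"
  proof (intro equalityI subsetI)
    fix e assume e: "e \<in> ?B"
    then have "e \<in> E" by simp
    then obtain u v where uv: "e = {u, v}" "u \<noteq> v" "u \<in> V" "v \<in> V"
      by (rule simple_graph_edgeE[OF G])
    then consider "u \<in> P" "v \<in> ?Q" | "v \<in> P" "u \<in> ?Q" using e P(1) by auto
    then show "e \<in> (\<lambda>(u, v). {u, v}) ` (P \<times> ?Q)"
      by cases (use uv in \<open>auto simp: image_iff insert_commute\<close>)
  next
    fix e assume "e \<in> (\<lambda>(u, v). {u, v}) ` (P \<times> ?Q)"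
    then obtain u v where uv: "e = {u, v}" "u \<in> P" "v \<in> ?Q" by auto
    then have "e \<notin> F1 \<union> F2" using F1(1) F2(1) by (auto simp: simple_graph_def)
    then show "e \<in> ?B" using uv P(1) by (auto simp: E complement_edges_def card_2_iff)
  qed
  moreover have "inj_on (\<lambda>(u, v). {u, v}) (P \<times> ?Q)"
    by (auto simp: inj_on_def doubleton_eq_iff)
  ultimately have "card ?B = card (P \<times> ?Q)" by (simp only: card_image)
  then have B: "real (card ?B) = real p * (real n - real p)"
    using cQ P(2) by (simp add: card_cartesian_product)
  have A: "real (card ?A) = real p * (real p + real k - real n) / 2"
    using card_edges_between_degree_classes[OF G P(1) degP] B P(2) by (simp add: algebra_simps)
  have "V - ?Q = P" using P(1) by auto
  then have "{e\<in>E. \<not> e \<subseteq> ?Q \<and> \<not> e \<subseteq> V - ?Q} = ?B" by auto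
  then have C: "real (card ?C) = (real n - real p) * (real m - real p) / 2"
    using card_edges_between_degree_classes[OF G _ degQ] B cQ by (simp add: algebra_simps)
  show prof: ?prof
    using degree_profile_two_classes[OF G P(1) assms(3) degP degQ] unfolding A B C cQ P(2) .
  show "randic_var E = real n / 2 - 1 / 2 * (1 / real k - 1 / real m) * (real p * (real n - real p))"
    using randic_var_of_degree_profile[OF G prof assms(2,3)] V(2) by simp
qed

section \<open>Existence of regular graphs\<close>

text \<open>
  These are the connection sets of the circulant graphs below. For even \<open>r\<close> the differences closest to
  \<open>0\<close> modulo \<open>p\<close> are taken. For odd \<open>r\<close> the set has to contain the fixed point \<open>p/2\<close> of \<open>s \<mapsto> p - s\<close>,
  and an interval around it is taken.
\<close>

lemma ex_symmetric_difference_set: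
  fixes p r :: nat
  assumes "r < p" "even (p * r)"
  obtains S where "S \<subseteq> {0<..<p}" "card S = r" "\<And>s. s \<in> S \<Longrightarrow> p - s \<in> S"
proof (cases "even r")
  case True
  then obtain h where h: "r = 2 * h" by (elim evenE)
  let ?S = "{0<..h} \<union> {p - h..<p}"
  have "card ?S = r" using h assms(1) by (subst card_Un_disjoint) auto
  then show ?thesis using h assms(1) by (intro that[of ?S]) auto
next
  case False
  then obtain h q where h: "r = 2 * h + 1" "p = 2 * q"
    using assms(2) by (auto elim!: oddE evenE)
  let ?S = "{q - h..q + h}"
  show ?thesis using h assms(1) by (intro that[of ?S]) auto
qed

text \<open>
  A circulant graph, with two vertices adjacent when their difference lies in a symmetric set \<open>S\<close>. The
  neighbours of a vertex \<open>w\<close> correspond to \<open>S\<close> by cyclic translation. The offset \<open>a\<close> makes it possible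
  to place two such graphs side by side.
\<close>

lemma ex_regular_graph:
  fixes a p r :: nat
  assumes "r < p" "even (p * r)"
  shows "\<exists>F. regular_graph r {a..<a + p} F"
proof -
  obtain S where S: "S \<subseteq> {0<..<p}" "card S = r" and sym: "\<And>s. s \<in> S \<Longrightarrow> p - s \<in> S"
    using ex_symmetric_difference_set[OF assms] by metis
  let ?V = "{a..<a + p}"
  define F where "F = {{u, v} | u v. u \<in> ?V \<and> v \<in> ?V \<and> u < v \<and> v - u \<in> S}"
  have G: "simple_graph ?V F"
    by (auto simp: simple_graph_def F_def card_2_iff)
  have inF: "{w, v} \<in> F \<longleftrightarrow> w < v \<and> v - w \<in> S \<or> v < w \<and> w - v \<in> S"
    if "w \<in> ?V" "v \<in> ?V" for v w
    using that unfolding F_def by (auto simp: doubleton_eq_iff)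
  have "degree F w = r" if w: "w \<in> ?V" for w
  proof -
    \<comment> \<open>Translation by \<open>w\<close>, wrapped around in the interval, and its inverse.\<close>
    let ?f = "\<lambda>s. if w + s < a + p then w + s else w + s - p"
    let ?g = "\<lambda>v. if w < v then v - w else p + v - w"
    have "bij_betw ?f S {v\<in>?V. {w, v} \<in> F}"
    proof (rule bij_betw_byWitness[where f' = ?g])
      show "\<forall>s\<in>S. ?g (?f s) = s" using S(1) w by fastforce
      show "\<forall>v\<in>{v\<in>?V. {w, v} \<in> F}. ?f (?g v) = v"
        using w inF[OF w] by auto
      show "?f ` S \<subseteq> {v\<in>?V. {w, v} \<in> F}"
      proof
        fix v assume "v \<in> ?f ` S"
        then obtain s where s: "s \<in> S" "v = ?f s" by auto
        then have s0: "0 < s" "s < p" using S(1) by auto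
        show "v \<in> {v\<in>?V. {w, v} \<in> F}"
        proof (cases "w + s < a + p")
          case True
          then show ?thesis using s s0 w inF[OF w, of v] by auto
        next
          case False
          then have "w - v = p - s" "v < w" "v \<in> ?V" using s s0 w by auto
          then show ?thesis using sym[OF s(1)] inF[OF w, of v] by auto
        qed
      qed
      show "?g ` {v\<in>?V. {w, v} \<in> F} \<subseteq> S"
      proof
        fix s assume "s \<in> ?g ` {v\<in>?V. {w, v} \<in> F}"
        then obtain v where v: "v \<in> ?V" "{w, v} \<in> F" "s = ?g v" by auto
        show "s \<in> S"
        proof (cases "w < v")
          case True
          then show ?thesis using v inF[OF w v(1)] by auto
        next
          case False
          then have "v < w" "w - v \<in> S" using v inF[OF w v(1)] by auto
          moreover from this have "s = p - (w - v)" using v w by auto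
          ultimately show ?thesis by (simp only: sym)
        qed
      qed
    qed
    from bij_betw_same_card[OF this] show ?thesis
      by (simp only: degree_eq_card_neighbours[OF G w] S(2))
  qed
  then show ?thesis using G unfolding regular_graph_def by blast
qed

lemma ex_complement_family:
  assumes "p \<le> n" "n - k - 1 < p" "even (p * (n - k - 1))"
    and "n - m - 1 < n - p" "even ((n - p) * (n - m - 1))"
  shows "\<exists>(V :: nat set) E. complement_family n p k m V E"
proof -
  obtain F1 where F1: "regular_graph (n - k - 1) {0..<0 + p} F1"
    using ex_regular_graph[OF assms(2,3)] by blast
  obtain F2 where F2: "regular_graph (n - m - 1) {p..<p + (n - p)} F2"
    using ex_regular_graph[OF assms(4,5)] by blast
  have "{0..<n} - {0..<p} = {p..<p + (n - p)}" using assms(1) by auto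
  with F1 F2 assms(1)
  have "complement_family n p k m {0..<n} (complement_edges {0..<n} (F1 \<union> F2))"
    unfolding complement_family_def
    by (intro conjI exI[of _ "{0..<p}"] exI[of _ F1] exI[of _ F2]) auto
  then show ?thesis by blast
qed

section \<open>The sharp bounds\<close>

theorem theorem2:
  fixes n k m :: nat
  assumes "0 < k" and "k \<le> m" and "m + 2 \<le> n"
  shows
    "(real k \<le> real n / 2 \<and> n - k \<le> m \<longrightarrow>
        (\<forall>(V :: 'a set) E. bounded_degree_graph n k m V E \<longrightarrow>
           randic_var E \<ge> real n / 2 - 1 / 2 * (1 / real k - 1 / real m) * (real k * (real n - real k))) \<and>
        (\<forall>(V :: 'a set) E. bounded_degree_graph n k m V E \<and>
           degree_profile V E k m (real n - real k) (real k)
             0 ((real n - real k) * real k) (real k * (real k + real m - real n) / 2) \<longrightarrow>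
           randic_var E = real n / 2 - 1 / 2 * (1 / real k - 1 / real m) * (real k * (real n - real k))) \<and>
        (even k \<or> odd k \<and> odd (n - m) \<longrightarrow>
           (\<exists>(V :: nat set) E. bounded_degree_graph n k m V E \<and>
              degree_profile V E k m (real n - real k) (real k)
                0 ((real n - real k) * real k) (real k * (real k + real m - real n) / 2) \<and>
              randic_var E = real n / 2 - 1 / 2 * (1 / real k - 1 / real m) * (real k * (real n - real k)))))
     \<and>
     (real n / 2 \<le> real k \<longrightarrow>
        (\<forall>(V :: 'a set) E. bounded_degree_graph n k m V E \<longrightarrow>
           randic_var E \<ge> real n / 2 - 1 / 2 * (1 / real k - 1 / real m) * ((real n)\<^sup>2 / 4)) \<and>
        (\<forall>(V :: 'a set) E. even n \<and> complement_family n (n div 2) k m V E \<longrightarrow>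
           bounded_degree_graph n k m V E \<and>
           degree_profile V E k m (real n / 2) (real n / 2)
             (real n * (2 * real k - real n) / 8) ((real n)\<^sup>2 / 4)
             (real n * (2 * real m - real n) / 8) \<and>
           randic_var E = real n / 2 - 1 / 2 * (1 / real k - 1 / real m) * ((real n)\<^sup>2 / 4)) \<and>
        (n mod 4 = 0 \<or> n mod 4 = 2 \<and> odd k \<and> odd m \<longrightarrow>
           (\<exists>(V :: nat set) E. complement_family n (n div 2) k m V E \<and>
              bounded_degree_graph n k m V E \<and>
              degree_profile V E k m (real n / 2) (real n / 2)
                (real n * (2 * real k - real n) / 8) ((real n)\<^sup>2 / 4)
                (real n * (2 * real m - real n) / 8) \<and>
              randic_var E = real n / 2 - 1 / 2 * (1 / real k - 1 / real m) * ((real n)\<^sup>2 / 4))))"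
proof -
  have mn: "m < n" using assms(3) by simp
  have half: "bounded_degree_graph n k m V E \<and>
      degree_profile V E k m (real n / 2) (real n / 2)
        (real n * (2 * real k - real n) / 8) ((real n)\<^sup>2 / 4) (real n * (2 * real m - real n) / 8) \<and>
      randic_var E = real n / 2 - 1 / 2 * (1 / real k - 1 / real m) * ((real n)\<^sup>2 / 4)"
    if "even n" and fam: "complement_family n (n div 2) k m V E" for V :: "'b set" and E
  proof -
    have "real n = 2 * real (n div 2)" using \<open>even n\<close> by auto
    then have p: "real (n div 2) = real n / 2" by simp
    have eqs: "real n - real n / 2 = real n / 2"
      "real n / 2 * (real n / 2 + real k - real n) / 2 = real n * (2 * real k - real n) / 8"
      "real n / 2 * (real n / 2) = (real n)\<^sup>2 / 4"
      "real n / 2 * (real m - real n / 2) / 2 = real n * (2 * real m - real n) / 8"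
      by (simp_all add: field_simps power2_eq_square)
    show ?thesis
      using complement_family_props[OF fam assms(1,2) mn] unfolding p eqs by blast
  qed
  show ?thesis
proof (intro conjI impI, goal_cases)
  case 1
  then have "2 * k \<le> n" by linarith
  then show ?case
    using randic_var_lower_bounds(2) assms by fastforce
next
  case 2
  show ?case
  proof (intro allI impI, elim conjE)
    fix V :: "'a set" and E
    assume G: "bounded_degree_graph n k m V E"
      and prof: "degree_profile V E k m (real n - real k) (real k)
             0 ((real n - real k) * real k) (real k * (real k + real m - real n) / 2)"
    then have "simple_graph V E" "card V = n" by (auto simp: bounded_degree_graph_def)
    then show "randic_var E = real n / 2 - 1 / 2 * (1 / real k - 1 / real m) * (real k * (real n - real k))"
      using randic_var_of_degree_profile[OF _ prof assms(1,2)] by (simp add: mult.commute)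
  qed
next
  case 3
  let ?p = "n - k"
  \<comment> \<open>A complete graph on \<open>n - k\<close> vertices is regular of degree \<open>n - k - 1\<close>, whatever the parity.\<close>
  have "even (?p * (n - k - 1))" by (cases "n - k") auto
  moreover have "even ((n - ?p) * (n - m - 1))"
    using 3(2) assms by auto
  ultimately obtain V :: "nat set" and E where fam: "complement_family n ?p k m V E"
    using ex_complement_family[of ?p n k m] 3(1) assms by fastforce
  have p: "real ?p = real n - real k" using assms by (simp add: of_nat_diff)
  show ?case
    using complement_family_props[OF fam assms(1,2) mn] unfolding p
    by (intro exI[of _ V] exI[of _ E]) (simp add: algebra_simps)
next
  case 4
  show ?case
    using randic_var_lower_bounds(1) assms by fastforce
next
  case 5
  show ?case using half by blast
next
  case 6
  let ?p = "n div 2"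
  have "even n" using 6(2) by presburger
  have "n - k - 1 < ?p" "n - m - 1 < n - ?p" using 6(1) assms by linarith+
  moreover have "even (?p * (n - k - 1))" "even ((n - ?p) * (n - m - 1))"
  proof -
    have other: "n - ?p = ?p" using \<open>even n\<close> by auto
    consider "n mod 4 = 0" | "odd k" "odd m" using 6(2) by metis
    then have "even ?p \<or> even (n - k - 1) \<and> even (n - m - 1)"
    proof cases
      case 1
      then have "even ?p" by presburger
      then show ?thesis ..
    next
      case 2
      then show ?thesis using \<open>even n\<close> assms by auto
    qed
    then show "even (?p * (n - k - 1))" "even ((n - ?p) * (n - m - 1))"
      unfolding other by auto
  qed
  ultimately obtain V :: "nat set" and E where fam: "complement_family n ?p k m V E"
    using ex_complement_family[of ?p n k m] by auto
  show ?case using half[OF \<open>even n\<close> fam] fam by blast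
qed
qed

end
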